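(* Let $\mathbf{D}\in\mathbb{R}^{M_1\times M_2}$ be a data matrix of rank $r_d$ with nonzero columns $\mathbf{d}_1,\dots,\mathbf{d}_{M_2}$ and compact singular value decomposition $\mathbf{D}=\mathbf{U}\Sigma\mathbf{V}^T$, where $\mathbf{U}\in\mathbb{R}^{M_1\times r_d}$ and $\mathbf{V}\in\mathbb{R}^{M_2\times r_d}$ have orthonormal columns and $\Sigma\in\mathbb{R}^{r_d\times r_d}$ is diagonal with the nonzero singular values on its diagonal. Let $\mathbf{v}^i\in\mathbb{R}^{r_d}$ denote the $i$-th row of $\mathbf{V}$ (viewed as a column vector). Let $\mathbf{C}^*\in\mathbb{R}^{M_1\times M_2}$ be an optimal point of $$\min_{\mathbf{C}}\ \|\mathbf{D}^T\mathbf{C}\|_{2,1}\quad\text{subject to}\quad \operatorname{diag}(\mathbf{C}^T\mathbf{D})=\mathbf{1},$$ and let $\mathbf{A}=|\mathbf{D}^T\mathbf{C}^*|$. Then for all $1\le i,j\le M_2$, $$\mathbf{A}(i,j)=\frac{|(\mathbf{v}^i)^T\mathbf{v}^j|}{\|\mathbf{v}^j\|_2^2}.$$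
   Context: For a matrix $\mathbf{B}$ with columns $\mathbf{b}_j$, $\|\mathbf{B}\|_{2,1}=\sum_j\|\mathbf{b}_j\|_2$. $|\mathbf{B}|$ denotes the entrywise absolute value. $\mathbf{1}$ is the all-ones vector and $\operatorname{diag}(\cdot)$ extracts the diagonal, so the constraint says $\mathbf{c}_i^T\mathbf{d}_i=1$ for every $i$, where $\mathbf{c}_i$ is the $i$-th column of $\mathbf{C}$. $\mathbf{A}(i,j)$ is the entry in row $i$ and column $j$ of $\mathbf{A}$. *)

theory Defs
  imports "HOL-Analysis.Analysis"
begin

text \<open>A real matrix with row indices in \<open>'m\<close> and column indices in \<open>'n\<close> has type
  \<open>real^'n^'m\<close>, so \<open>B $ i $ j\<close> is the entry in row \<open>i\<close> and column \<open>j\<close>, and the library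
  instance of absolute value on this type is taken entrywise.\<close>

definition norm_2_1 :: "real^'n^'m \<Rightarrow> real" where
  "norm_2_1 B = (\<Sum>j\<in>UNIV. norm (column j B))"

definition diag_vec :: "real^'n^'n \<Rightarrow> real^'n" where
  "diag_vec B = (\<chi> i. B $ i $ i)"

definition orthonormal_columns :: "real^'n^'m \<Rightarrow> bool" where
  "orthonormal_columns B \<longleftrightarrow>
     (\<forall>i j. column i B \<bullet> column j B = (if i = j then 1 else 0))"

text \<open>The factorization with orthonormal columns and positive diagonal entries makes these entries
  exactly the nonzero singular values of \<open>D\<close>, with multiplicity. The index type \<open>'r\<close> carries no
  order, so they are not required to be sorted.\<close>

definition compact_svd ::
  "real^'n^'m \<Rightarrow> real^'r^'m \<Rightarrow> real^'r^'r \<Rightarrow> real^'r^'n \<Rightarrow> bool" where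
  "compact_svd D U S V \<longleftrightarrow>
     CARD('r) = rank D \<and>
     orthonormal_columns U \<and>
     orthonormal_columns V \<and>
     (\<forall>k l. k \<noteq> l \<longrightarrow> S $ k $ l = 0) \<and>
     (\<forall>k. S $ k $ k > 0) \<and>
     D = U ** S ** transpose V"

end

theory Submission
  imports Defs
begin

text \<open>Put \<open>W = \<Sigma> U\<^sup>T\<close>, so that \<open>D\<^sup>T C = V X\<close> with \<open>X = W C\<close>. As \<open>W\<close> has a right
  inverse, \<open>X\<close> ranges over all matrices, and as \<open>V\<close> is an isometry, the problem decouples over the
  columns of \<open>X\<close>: minimize \<open>\<parallel>x\<^sub>j\<parallel>\<close> subject to \<open>v\<^sup>j \<bullet> x\<^sub>j = 1\<close>. By Cauchy-Schwarz the unique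
  minimizer is \<open>x\<^sub>j = v\<^sup>j / \<parallel>v\<^sup>j\<parallel>\<^sup>2\<close>.\<close>

lemma matrix_mult_component_inner_row_column:
  fixes A :: "real^'n^'m" and B :: "real^'p^'n"
  shows "(A ** B) $ i $ j = row i A \<bullet> column j B"
  by (simp add: matrix_matrix_mult_def row_def column_def inner_vec_def)

lemma orthonormal_columns_iff:
  "orthonormal_columns B \<longleftrightarrow> transpose B ** B = mat 1"
  by (auto simp: orthonormal_columns_def vec_eq_iff matrix_mult_component_inner_row_column mat_def)

text \<open>\<open>V ** X\<close> and \<open>X\<close> have the same Gram matrix because
  \<open>transpose V ** V = mat 1\<close>, and the diagonal of the Gram matrix holds the squared
  column norms.\<close>

lemma norm_2_1_orthonormal_mult:
  fixes V :: "real^'r^'n" and X :: "real^'p^'r"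
  assumes "orthonormal_columns V"
  shows "norm_2_1 (V ** X) = norm_2_1 X"
proof -
  have "column j (V ** X) \<bullet> column j (V ** X) = column j X \<bullet> column j X" for j
  proof -
    have "transpose (V ** X) ** (V ** X) = transpose X ** (transpose V ** V) ** X"
      by (simp add: matrix_transpose_mul matrix_mul_assoc)
    also have "\<dots> = transpose X ** X"
      using assms by (simp add: orthonormal_columns_iff)
    finally show ?thesis
      by (metis matrix_mult_component_inner_row_column row_transpose)
  qed
  then show ?thesis
    by (simp add: norm_2_1_def norm_eq_sqrt_inner)
qed

lemma norm_ge_inverse_if_inner_eq_1:
  fixes v x :: "'a::real_inner"
  assumes "v \<bullet> x = 1"
  shows "inverse (norm v) \<le> norm x"
proof -
  have "1 \<le> norm v * norm x" "v \<noteq> 0"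
    using norm_cauchy_schwarz[of v x] assms by auto
  then show ?thesis
    by (simp add: field_simps)
qed

text \<open>This is the equality case of Cauchy-Schwarz. With
  \<open>c = 1 / (norm v)\<^sup>2\<close>, the squared distance from \<open>x\<close> to
  \<open>c *\<^sub>R v\<close> expands to c - 2c + c = 0.\<close>

lemma min_norm_inner_eq_1_unique:
  fixes v x :: "'a::real_inner"
  assumes "v \<bullet> x = 1" and "norm x = inverse (norm v)"
  shows "x = (1 / (norm v)\<^sup>2) *\<^sub>R v"
proof -
  define c where "c = 1 / (norm v)\<^sup>2"
  have "v \<noteq> 0"
    using assms(1) by auto
  then have v: "c * (v \<bullet> v) = 1"
    by (simp add: c_def dot_square_norm)
  have x: "x \<bullet> x = c"
    using assms(2) by (simp add: c_def dot_square_norm inverse_eq_divide power_divide)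
  have "(x - c *\<^sub>R v) \<bullet> (x - c *\<^sub>R v) = x \<bullet> x - 2 * c * (v \<bullet> x) + c * (c * (v \<bullet> v))"
    by (simp only: inner_diff_left inner_diff_right inner_scaleR_left inner_scaleR_right
        inner_commute[of x v]) (simp add: algebra_simps)
  also have "\<dots> = 0"
    using assms(1) by (simp add: v x)
  finally show ?thesis
    by (simp add: c_def)
qed

text \<open>The right inverse \<open>R\<close> makes \<open>C \<mapsto> W ** C\<close> surjective,
  so a competitor may be chosen as a value of \<open>W ** C\<close> and pulled back through
  \<open>R\<close>.\<close>

lemma compact_svd_transpose_factor:
  fixes D :: "real^'n^'m" and V :: "real^'r^'n"
  assumes "compact_svd D U S V"
  obtains W :: "real^'m^'r" and R :: "real^'r^'m"
  where "transpose D = V ** W" and "W ** R = mat 1"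
proof
  \<comment> \<open>\<open>T\<close> inverts the diagonal matrix \<open>S\<close>, whose diagonal is
    positive; the right inverse of \<open>transpose S ** transpose U\<close> is then
    \<open>U ** T\<close>.\<close>
  define T :: "real^'r^'r" where "T = (\<chi> k l. if k = l then 1 / S $ k $ k else 0)"
  have off: "S $ k $ l = 0" if "k \<noteq> l" for k l
    using assms that by (simp add: compact_svd_def)
  have pos: "S $ k $ k > 0" for k
    using assms by (simp add: compact_svd_def)
  have "(\<Sum>m\<in>UNIV. S $ m $ k * T $ m $ l) = S $ l $ k / S $ l $ l" for k l
    by (simp add: T_def if_distrib sum.delta cong: if_cong)
  then have ST: "transpose S ** T = mat 1"
    using off pos by (auto simp: vec_eq_iff matrix_matrix_mult_def transpose_def mat_def)
      (metis less_irrefl)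
  show "transpose D = V ** (transpose S ** transpose U)"
    using assms by (simp add: compact_svd_def matrix_transpose_mul)
  have "transpose S ** transpose U ** (U ** T) = transpose S ** (transpose U ** U) ** T"
    by (simp add: matrix_mul_assoc)
  then show "transpose S ** transpose U ** (U ** T) = mat 1"
    using assms ST by (simp add: compact_svd_def orthonormal_columns_iff)
qed

theorem lemma1:
  fixes D C_opt :: "real^'m2^'m1"
    and U :: "real^'r^'m1"
    and \<Sigma> :: "real^'r^'r"
    and V :: "real^'r^'m2"
    and A :: "real^'m2^'m2"
  assumes "\<And>j. column j D \<noteq> 0"
    and "compact_svd D U \<Sigma> V"
    and "is_arg_min (\<lambda>C. norm_2_1 (transpose D ** C))
           (\<lambda>C. diag_vec (transpose C ** D) = vec 1) C_opt"
    and "A = \<bar>transpose D ** C_opt\<bar>"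
  shows "\<forall>i j. A $ i $ j = \<bar>row i V \<bullet> row j V\<bar> / (norm (row j V))\<^sup>2"
proof -
  obtain W :: "real^'m1^'r" and R :: "real^'r^'m1"
    where DW: "transpose D = V ** W" and WR: "W ** R = mat 1"
    using compact_svd_transpose_factor[OF assms(2)] .
  have V: "orthonormal_columns V"
    using assms(2) by (simp add: compact_svd_def)
  have entry: "(transpose D ** C) $ i $ j = row i V \<bullet> column j (W ** C)"
    for C :: "real^'m2^'m1" and i j
    by (simp add: DW matrix_mult_component_inner_row_column flip: matrix_mul_assoc)
  have objective: "norm_2_1 (transpose D ** C) = (\<Sum>j\<in>UNIV. norm (column j (W ** C)))"
    for C :: "real^'m2^'m1"
    using norm_2_1_orthonormal_mult[OF V, of "W ** C"]
    by (simp add: DW matrix_mul_assoc norm_2_1_def)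
  have feasible: "diag_vec (transpose C ** D) = vec 1 \<longleftrightarrow>
      (\<forall>j. row j V \<bullet> column j (W ** C) = 1)" for C :: "real^'m2^'m1"
  proof -
    \<comment> \<open>The two products are transposes of each other, so they share their
      diagonal.\<close>
    have "(transpose C ** D) $ j $ j = (transpose D ** C) $ j $ j" for j
      by (simp add: matrix_mult_component_inner_row_column inner_commute)
    then show ?thesis
      by (simp add: diag_vec_def vec_eq_iff entry)
  qed
  \<comment> \<open>A zero row of \<open>V\<close> would force a zero column of \<open>D\<close>.
    Nonzero rows are what makes the candidate \<open>X0\<close> below feasible.\<close>
  have row_nz: "row j V \<noteq> 0" for j
  proof
    assume "row j V = 0"
    then have "row j (transpose D) = 0"
      by (simp add: DW vec_eq_iff row_def matrix_matrix_mult_def)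
    then show False
      using assms(1)[of j] by simp
  qed
  define x where "x j = column j (W ** C_opt)" for j
  \<comment> \<open>The columns of \<open>X0\<close> are the minimizers of the decoupled problems,
    and \<open>R ** X0\<close> is a matrix \<open>C\<close> with \<open>W ** C = X0\<close>, to be
    compared with \<open>C_opt\<close>.\<close>
  define X0 :: "real^'m2^'r" where "X0 = (\<chi> k j. V $ j $ k / (norm (row j V))\<^sup>2)"
  have col_X0: "column j X0 = (1 / (norm (row j V))\<^sup>2) *\<^sub>R row j V" for j
    by (simp add: X0_def column_def row_def vec_eq_iff)
  have WRX0: "W ** (R ** X0) = X0"
    by (simp add: matrix_mul_assoc WR)
  have x_feasible: "row j V \<bullet> x j = 1" for j
    using assms(3) feasible unfolding is_arg_min_def x_def by blast
  have "diag_vec (transpose (R ** X0) ** D) = vec 1"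
    unfolding feasible using row_nz by (simp add: WRX0 col_X0 dot_square_norm)
  then have "norm_2_1 (transpose D ** C_opt) \<le> norm_2_1 (transpose D ** (R ** X0))"
    using assms(3) by (force simp: is_arg_min_def not_less)
  moreover have "norm (column j X0) = inverse (norm (row j V))" for j
    using row_nz[of j] by (simp add: col_X0 field_simps power2_eq_square)
  ultimately have "(\<Sum>j\<in>UNIV. norm (x j)) \<le> (\<Sum>j\<in>UNIV. inverse (norm (row j V)))"
    by (simp add: objective WRX0 x_def)
  moreover have lower: "inverse (norm (row j V)) \<le> norm (x j)" for j
    using x_feasible by (rule norm_ge_inverse_if_inner_eq_1)
  \<comment> \<open>Optimality bounds the sum from above and the columnwise bounds
    \<open>lower\<close> bound it from below. Equality of the sums then forces equality in every
    column.\<close>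
  ultimately have "(\<Sum>j\<in>UNIV. inverse (norm (row j V))) = (\<Sum>j\<in>UNIV. norm (x j))"
    by (meson antisym sum_mono)
  then have "inverse (norm (row j V)) = norm (x j)" for j
    using lower by (rule sum_mono_inv) auto
  then have "x j = (1 / (norm (row j V))\<^sup>2) *\<^sub>R row j V" for j
    by (intro min_norm_inner_eq_1_unique x_feasible) simp
  moreover have "A $ i $ j = \<bar>row i V \<bullet> x j\<bar>" for i j
    by (simp add: assms(4) abs_vec_def entry x_def)
  ultimately show ?thesis
    by (simp add: abs_mult)
qed

end
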